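(* Let $B$ be a left semi-brace. Then $E$ is an ideal of $B$ if and only if $a\cdot b=g_a\cdot g_b$ for all $a,b\in B$.
   Context: A left semi-brace is a set $B$ with two operations $+$ and $\circ$ such that $(B,+)$ is a left cancellative semigroup (not necessarily commutative), $(B,\circ)$ is a group, and $a\circ(b+c)=a\circ b+a\circ(a^-+c)$ for all $a,b,c\in B$, where $a^-$ is the inverse of $a$ in $(B,\circ)$ and $\circ$ has higher precedence than $+$. The identity of $(B,\circ)$ is denoted $0$; it is an idempotent and a left identity of $(B,+)$. Let $E$ be the set of idempotents of $(B,+)$ and $G=B+0=\{b+0: b\in B\}$, which is a subgroup of $(B,+)$ (with identity $0$). Every $b\in B$ can be written uniquely as $b=g_b+e_b$ with $g_b\in G$, $e_b\in E$; one has $g_b=b+0$. For $a,b\in B$ put $\lambda_a(b)=a\circ(a^-+b)$, $\rho_b(a)=(a^-+b)^-\circ b$, and define the operation $a\cdot b=\lambda_a(a^-)+a\circ b+\lambda_b(b^-)$. A subsemigroup $I$ of $(B,+)$ is an ideal of $B$ if: (i) $I$ is a normal subgroup of $(B,\circ)$; (ii) $I\cap G$ is a normal subgroup of $(G,+)$; (iii) $\rho_b(n)\in I$ for all $b\in B$, $n\in I\cap G$; (iv) $\lambda_g(e)\in I$ for all $g\in G$, $e\in I\cap E$. *)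

theory Defs
  imports "HOL-Algebra.Coset"
begin

text \<open>
  A structure with two operations: the inherited multiplication \<open>\<otimes>\<close> plays the role of the
  circle operation, and \<open>\<boxplus>\<close> that of the (in general non-commutative) addition.
  The identity \<open>\<one>\<close> of \<open>\<otimes>\<close> is the element traditionally written \<open>0\<close>.
\<close>

record 'a semi_brace = "'a monoid" +
  plus :: "['a, 'a] \<Rightarrow> 'a" (infixl "\<boxplus>\<index>" 65)

locale left_semi_brace = group B for B (structure) +
  assumes plus_closed: "\<lbrakk>a \<in> carrier B; b \<in> carrier B\<rbrakk> \<Longrightarrow> a \<boxplus> b \<in> carrier B"
    and plus_assoc: "\<lbrakk>a \<in> carrier B; b \<in> carrier B; c \<in> carrier B\<rbrakk>
      \<Longrightarrow> (a \<boxplus> b) \<boxplus> c = a \<boxplus> (b \<boxplus> c)"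
    and plus_left_cancel: "\<lbrakk>a \<in> carrier B; b \<in> carrier B; c \<in> carrier B; a \<boxplus> b = a \<boxplus> c\<rbrakk>
      \<Longrightarrow> b = c"
    and left_distrib: "\<lbrakk>a \<in> carrier B; b \<in> carrier B; c \<in> carrier B\<rbrakk>
      \<Longrightarrow> a \<otimes> (b \<boxplus> c) = (a \<otimes> b) \<boxplus> (a \<otimes> (inv a \<boxplus> c))"

definition idems :: "('a, 'm) semi_brace_scheme \<Rightarrow> 'a set" where
  "idems B = {e \<in> carrier B. e \<boxplus>\<^bsub>B\<^esub> e = e}"

definition gset :: "('a, 'm) semi_brace_scheme \<Rightarrow> 'a set" where
  "gset B = (\<lambda>b. b \<boxplus>\<^bsub>B\<^esub> \<one>\<^bsub>B\<^esub>) ` carrier B"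

definition add_group :: "('a, 'm) semi_brace_scheme \<Rightarrow> 'a monoid" where
  "add_group B = \<lparr>carrier = gset B, mult = plus B, one = \<one>\<^bsub>B\<^esub>\<rparr>"

text \<open>Existence and uniqueness of this component, and its value \<open>b \<boxplus> \<one>\<close>, are shown below.\<close>

definition gpart :: "('a, 'm) semi_brace_scheme \<Rightarrow> 'a \<Rightarrow> 'a" where
  "gpart B b = (THE g. g \<in> gset B \<and> (\<exists>e \<in> idems B. b = g \<boxplus>\<^bsub>B\<^esub> e))"

definition lam :: "('a, 'm) semi_brace_scheme \<Rightarrow> 'a \<Rightarrow> 'a \<Rightarrow> 'a" where
  "lam B a b = a \<otimes>\<^bsub>B\<^esub> (inv\<^bsub>B\<^esub> a \<boxplus>\<^bsub>B\<^esub> b)"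

text \<open>The subscript comes first: \<open>rho B b a\<close> is \<open>\<rho>\<^sub>b(a)\<close>.\<close>

definition rho :: "('a, 'm) semi_brace_scheme \<Rightarrow> 'a \<Rightarrow> 'a \<Rightarrow> 'a" where
  "rho B b a = inv\<^bsub>B\<^esub> (inv\<^bsub>B\<^esub> a \<boxplus>\<^bsub>B\<^esub> b) \<otimes>\<^bsub>B\<^esub> b"

definition dot :: "('a, 'm) semi_brace_scheme \<Rightarrow> 'a \<Rightarrow> 'a \<Rightarrow> 'a" where
  "dot B a b = lam B a (inv\<^bsub>B\<^esub> a) \<boxplus>\<^bsub>B\<^esub> (a \<otimes>\<^bsub>B\<^esub> b) \<boxplus>\<^bsub>B\<^esub> lam B b (inv\<^bsub>B\<^esub> b)"

definition semi_brace_ideal :: "('a, 'm) semi_brace_scheme \<Rightarrow> 'a set \<Rightarrow> bool" where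
  "semi_brace_ideal B I \<longleftrightarrow>
     I \<subseteq> carrier B \<and> (\<forall>x \<in> I. \<forall>y \<in> I. x \<boxplus>\<^bsub>B\<^esub> y \<in> I) \<and>
     I \<lhd> B \<and>
     (I \<inter> gset B) \<lhd> add_group B \<and>
     (\<forall>b \<in> carrier B. \<forall>n \<in> I \<inter> gset B. rho B b n \<in> I) \<and>
     (\<forall>g \<in> gset B. \<forall>e \<in> I \<inter> idems B. lam B g e \<in> I)"

context left_semi_brace
begin

lemma one_plus:
  assumes "c \<in> carrier B"
  shows "\<one> \<boxplus> c = c"
proof -
  have "\<one> \<boxplus> c = \<one> \<boxplus> (\<one> \<boxplus> c)"
    using left_distrib[of \<one> \<one> c] assms by (simp add: plus_closed)
  then show ?thesis
    using plus_left_cancel[of \<one> c "\<one> \<boxplus> c"] assms by (simp add: plus_closed)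
qed

lemma one_idem: "\<one> \<in> idems B"
  by (simp add: idems_def one_plus)

lemma idem_plus:
  assumes "e \<in> idems B" "c \<in> carrier B"
  shows "e \<boxplus> c = c"
proof -
  have e: "e \<in> carrier B" "e \<boxplus> e = e" using assms by (auto simp: idems_def)
  have "e \<boxplus> (e \<boxplus> c) = e \<boxplus> c"
    using plus_assoc[of e e c] e assms(2) by simp
  then show ?thesis
    using plus_left_cancel[of e "e \<boxplus> c" c] e assms(2) by (simp add: plus_closed)
qed

lemma gset_carrier: "g \<in> gset B \<Longrightarrow> g \<in> carrier B"
  by (auto simp: gset_def plus_closed)

lemma gset_plus_one: "g \<in> gset B \<Longrightarrow> g \<boxplus> \<one> = g"
  by (auto simp: gset_def plus_assoc one_plus)

lemma plus_one_gset: "b \<in> carrier B \<Longrightarrow> b \<boxplus> \<one> \<in> gset B"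
  by (auto simp: gset_def)

lemma lam_closed: "\<lbrakk>a \<in> carrier B; b \<in> carrier B\<rbrakk> \<Longrightarrow> lam B a b \<in> carrier B"
  by (simp add: lam_def plus_closed)

lemma plus_lam_inv:
  assumes "a \<in> carrier B"
  shows "a \<boxplus> lam B a (inv a) = \<one>"
  using left_distrib[of a \<one> "inv a"] assms by (simp add: lam_def one_plus)

lemma group_add_group: "group (add_group B)"
proof -
  have cl: "x \<boxplus> y \<in> gset B" if "x \<in> gset B" "y \<in> gset B" for x y
    using plus_one_gset[of "x \<boxplus> y"] that
    by (simp add: plus_assoc gset_carrier gset_plus_one plus_closed)
  have one: "\<one> \<in> gset B" using plus_one_gset[of \<one>] by (simp add: one_plus)
  have right: "\<exists>y \<in> gset B. x \<boxplus> y = \<one>" if "x \<in> gset B" for x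
  proof
    have x: "x \<in> carrier B" using that by (rule gset_carrier)
    show "lam B x (inv x) \<boxplus> \<one> \<in> gset B"
      using x by (simp add: plus_one_gset lam_closed)
    have "x \<boxplus> (lam B x (inv x) \<boxplus> \<one>) = (x \<boxplus> lam B x (inv x)) \<boxplus> \<one>"
      using x by (simp add: plus_assoc lam_closed)
    then show "x \<boxplus> (lam B x (inv x) \<boxplus> \<one>) = \<one>"
      using x by (simp add: plus_lam_inv one_plus)
  qed
  have left: "\<exists>y \<in> gset B. y \<boxplus> x = \<one>" if x: "x \<in> gset B" for x
  proof -
    obtain y where y: "y \<in> gset B" "x \<boxplus> y = \<one>" using right[OF x] by blast
    have c: "x \<in> carrier B" "y \<in> carrier B" using x y by (auto intro: gset_carrier)
    have "x \<boxplus> (y \<boxplus> x) = x \<boxplus> \<one>"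
      using plus_assoc[of x y x] c y(2) gset_plus_one[OF x] by (simp add: one_plus)
    then have "y \<boxplus> x = \<one>"
      using plus_left_cancel[of x "y \<boxplus> x" \<one>] c by (simp add: plus_closed)
    then show ?thesis using y(1) by blast
  qed
  show ?thesis
    by (rule groupI) (auto simp: add_group_def cl one left one_plus plus_assoc gset_carrier)
qed

lemma decomp_exists:
  assumes b: "b \<in> carrier B"
  shows "\<exists>e \<in> idems B. b = (b \<boxplus> \<one>) \<boxplus> e"
proof -
  let ?l = "lam B b (inv b)"
  have l: "?l \<in> carrier B" using b by (simp add: lam_closed)
  have *: "b \<boxplus> (?l \<boxplus> x) = x" if "x \<in> carrier B" for x
    using plus_assoc[of b ?l x] b l that by (simp add: plus_lam_inv one_plus)
  have "(?l \<boxplus> b) \<boxplus> (?l \<boxplus> b) = ?l \<boxplus> b"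
    using b l by (simp add: plus_assoc plus_closed *)
  then have "?l \<boxplus> b \<in> idems B" using b l by (simp add: idems_def plus_closed)
  moreover have "b = (b \<boxplus> \<one>) \<boxplus> (?l \<boxplus> b)"
    using b l by (simp add: plus_assoc plus_closed one_plus *)
  ultimately show ?thesis by blast
qed

lemma decomp_gpart:
  assumes "g \<in> gset B" "e \<in> idems B" "b = g \<boxplus> e"
  shows "g = b \<boxplus> \<one>"
proof -
  have "e \<in> carrier B" using assms(2) by (simp add: idems_def)
  then have "b \<boxplus> \<one> = g \<boxplus> (e \<boxplus> \<one>)"
    using assms by (simp add: plus_assoc gset_carrier)
  then show ?thesis using assms by (simp add: idem_plus gset_plus_one)
qed

lemma decomp_unique:
  assumes "b \<in> carrier B"
  shows "\<exists>!(g, e). g \<in> gset B \<and> e \<in> idems B \<and> b = g \<boxplus> e"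
proof -
  obtain e where e: "e \<in> idems B" "b = (b \<boxplus> \<one>) \<boxplus> e"
    using decomp_exists[OF assms] by blast
  show ?thesis
  proof (rule ex1I[of _ "(b \<boxplus> \<one>, e)"])
    show "case (b \<boxplus> \<one>, e) of (g, e) \<Rightarrow> g \<in> gset B \<and> e \<in> idems B \<and> b = g \<boxplus> e"
      using e assms by (simp add: plus_one_gset)
  next
    fix p assume "case p of (g, e) \<Rightarrow> g \<in> gset B \<and> e \<in> idems B \<and> b = g \<boxplus> e"
    then obtain g f where p: "p = (g, f)" "g \<in> gset B" "f \<in> idems B" "b = g \<boxplus> f"
      by (cases p) auto
    have g: "g = b \<boxplus> \<one>" using p by (intro decomp_gpart)
    have "(b \<boxplus> \<one>) \<boxplus> f = (b \<boxplus> \<one>) \<boxplus> e" using p(4) e(2) g by simp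
    then have "f = e"
      using plus_left_cancel[of "b \<boxplus> \<one>" f e] p(3) e(1) assms
      by (simp add: idems_def plus_closed)
    then show "p = (b \<boxplus> \<one>, e)" using p(1) g by simp
  qed
qed

lemma gpart_eq:
  assumes "b \<in> carrier B"
  shows "gpart B b = b \<boxplus> \<one>"
  unfolding gpart_def
  using decomp_exists[OF assms] plus_one_gset[OF assms] decomp_gpart
  by (intro the_equality) blast+

end

end

theory Submission
  imports Defs
begin

text \<open>
  Write \<open>ab\<close> for the product in \<open>(B, \<otimes>)\<close>, \<open>0\<close> for its identity, \<open>a\<^sup>-\<close> for the inverse, \<open>E\<close> for
  the set of additive idempotents and \<open>g\<^sub>b = b + 0\<close>. The maps \<open>\<lambda>\<^sub>a\<close> are additive with \<open>\<lambda>\<^bsub>ab\<^esub> = \<lambda>\<^sub>a \<lambda>\<^sub>b\<close>, and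
  \<open>ab = a + \<lambda>\<^sub>a(b)\<close>. They preserve \<open>E\<close>, which is therefore a subgroup of \<open>(B, \<otimes>)\<close>; moreover
  \<open>x + 0 = y + 0\<close> holds exactly when \<open>x\<close> and \<open>y\<close> lie in the same left coset of \<open>E\<close>
  (\<open>plus_one_eq_iff\<close>).

  Since \<open>E\<close> meets \<open>B + 0\<close> only in \<open>0\<close>, all conditions for \<open>E\<close> to be an ideal hold automatically,
  except that \<open>E\<close> is normal in \<open>(B, \<otimes>)\<close> (\<open>ideal_idems_iff_normal\<close>).

  On the other side, \<open>\<lambda>\<^sub>a(a\<^sup>-)\<close> depends only on the left coset \<open>aE\<close>: for \<open>f \<in> E\<close> one has
  \<open>(af)\<^sup>- = f\<^sup>-a\<^sup>- = \<lambda>\<^bsub>f\<^sup>-\<^esub>(a\<^sup>-)\<close>, because \<open>f\<^sup>-\<close> is a left additive identity, and hence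
  \<open>\<lambda>\<^bsub>af\<^esub>((af)\<^sup>-) = \<lambda>\<^sub>a(a\<^sup>-)\<close>. So the outer summands of \<open>a \<cdot> b\<close> and \<open>g\<^sub>a \<cdot> g\<^sub>b\<close> agree, and cancelling
  them shows that \<open>a \<cdot> b = g\<^sub>a \<cdot> g\<^sub>b\<close> means \<open>ab + 0 = g\<^sub>a g\<^sub>b + 0\<close>, that is, \<open>abE = g\<^sub>a g\<^sub>b E\<close>. If
  \<open>E\<close> is normal this follows from \<open>a \<in> g\<^sub>a E\<close> and \<open>b \<in> g\<^sub>b E\<close>. Conversely, for \<open>a = e \<in> E\<close> it
  says that \<open>ebE = g\<^sub>b E = bE\<close>, so \<open>b\<^sup>-eb \<in> E\<close>.
\<close>

context left_semi_brace
begin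

lemma idems_carrier: "e \<in> idems B \<Longrightarrow> e \<in> carrier B"
  by (simp add: idems_def)

lemma mult_eq_plus_lam:
  assumes "a \<in> carrier B" "b \<in> carrier B"
  shows "a \<otimes> b = a \<boxplus> lam B a b"
  using left_distrib[of a \<one> b] assms by (simp add: lam_def one_plus)

lemma lam_plus:
  assumes "a \<in> carrier B" "b \<in> carrier B" "c \<in> carrier B"
  shows "lam B a (b \<boxplus> c) = lam B a b \<boxplus> lam B a c"
  using left_distrib[of a "inv a \<boxplus> b" c] assms
  by (simp add: lam_def plus_assoc plus_closed)

lemma lam_mult:
  assumes "a \<in> carrier B" "b \<in> carrier B" "c \<in> carrier B"
  shows "lam B (a \<otimes> b) c = lam B a (lam B b c)"
proof -
  have "b \<otimes> (inv b \<otimes> inv a \<boxplus> c) = inv a \<boxplus> lam B b c"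
    using left_distrib[of b "inv b \<otimes> inv a" c] assms
    by (simp add: lam_def m_assoc[symmetric])
  then show ?thesis
    using assms by (simp add: lam_def inv_mult_group m_assoc plus_closed)
qed

lemma lam_one: "c \<in> carrier B \<Longrightarrow> lam B \<one> c = c"
  by (simp add: lam_def one_plus plus_closed)

lemma plus_eq_mult_lam:
  assumes "a \<in> carrier B" "b \<in> carrier B"
  shows "a \<boxplus> b = a \<otimes> lam B (inv a) b"
  using assms by (simp add: lam_def m_assoc[symmetric] plus_closed)

lemma lam_idems:
  assumes "a \<in> carrier B" "e \<in> idems B"
  shows "lam B a e \<in> idems B"
  using assms lam_plus[of a e e] by (simp add: idems_def lam_closed)

lemma idem_mult:
  assumes "e \<in> idems B" "b \<in> carrier B"
  shows "e \<otimes> b = lam B e b"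
  using assms by (simp add: mult_eq_plus_lam idem_plus idems_carrier lam_closed)

lemma subgroup_idems: "subgroup (idems B) B"
proof (rule subgroupI)
  show "idems B \<subseteq> carrier B" by (auto simp: idems_def)
  show "idems B \<noteq> {}" using one_idem by blast
  show "e \<otimes> f \<in> idems B" if "e \<in> idems B" "f \<in> idems B" for e f
    using that by (simp add: idem_mult idems_carrier lam_idems)
  show "inv e \<in> idems B" if e: "e \<in> idems B" for e
  proof -
    have c: "e \<in> carrier B" using e by (rule idems_carrier)
    have "lam B (inv e) (lam B e (inv e)) = inv e"
      using c lam_mult[of "inv e" e "inv e"] by (simp add: lam_one)
    moreover have "lam B e (inv e) = \<one>"
      using e c idem_mult[of e "inv e"] by simp
    ultimately show ?thesis using lam_idems[of "inv e" \<one>] c one_idem by simp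
  qed
qed

lemma plus_one_eq_iff:
  assumes x: "x \<in> carrier B" and y: "y \<in> carrier B"
  shows "x \<boxplus> \<one> = y \<boxplus> \<one> \<longleftrightarrow> inv y \<otimes> x \<in> idems B"
proof
  assume eq: "x \<boxplus> \<one> = y \<boxplus> \<one>"
  obtain e where e: "e \<in> idems B" "x = (x \<boxplus> \<one>) \<boxplus> e"
    using decomp_exists[OF x] by blast
  have ec: "e \<in> carrier B" using e(1) by (rule idems_carrier)
  have "x = y \<boxplus> e" using e(2) eq y ec by (simp add: plus_assoc one_plus)
  then have "x = y \<otimes> lam B (inv y) e" using y ec by (simp add: plus_eq_mult_lam)
  then have "inv y \<otimes> x = lam B (inv y) e"
    using y ec by (simp add: m_assoc[symmetric] lam_closed)
  then show "inv y \<otimes> x \<in> idems B" using lam_idems[of "inv y" e] y e(1) by simp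
next
  assume f: "inv y \<otimes> x \<in> idems B"
  let ?e = "lam B y (inv y \<otimes> x)"
  have e: "?e \<in> idems B" using f y by (simp add: lam_idems)
  have "x = y \<otimes> (inv y \<otimes> x)" using x y by (simp add: m_assoc[symmetric])
  then have "x = y \<boxplus> ?e" using mult_eq_plus_lam[of y "inv y \<otimes> x"] x y by simp
  then have "x \<boxplus> \<one> = y \<boxplus> (?e \<boxplus> \<one>)"
    using plus_assoc[of y ?e \<one>] y idems_carrier[OF e] by simp
  then show "x \<boxplus> \<one> = y \<boxplus> \<one>" using e by (simp add: idem_plus)
qed

text \<open>The additive decomposition \<open>b = g\<^sub>b + e\<^sub>b\<close> in multiplicative form: \<open>b\<close> lies in the coset \<open>g\<^sub>b E\<close>,
  though in general its factor in \<open>E\<close> is not \<open>e\<^sub>b\<close> but \<open>\<lambda>\<^sub>a(e\<^sub>b)\<close> for \<open>a = g\<^sub>b\<^sup>-\<close>.\<close>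

lemma decomp_mult:
  assumes "b \<in> carrier B"
  obtains f where "f \<in> idems B" "b = gpart B b \<otimes> f"
proof
  let ?g = "gpart B b"
  have g: "?g \<in> carrier B" using assms by (simp add: gpart_eq plus_closed)
  have "b \<boxplus> \<one> = ?g \<boxplus> \<one>" using assms by (simp add: gpart_eq plus_assoc one_plus)
  then show "inv ?g \<otimes> b \<in> idems B" using plus_one_eq_iff[OF assms g] by simp
  show "b = ?g \<otimes> (inv ?g \<otimes> b)" using assms g by (simp add: m_assoc[symmetric])
qed

lemma lam_inv_mult_idem:
  assumes a: "a \<in> carrier B" and f: "f \<in> idems B"
  shows "lam B (a \<otimes> f) (inv (a \<otimes> f)) = lam B a (inv a)"
proof -
  have fc: "f \<in> carrier B" using f by (rule idems_carrier)
  have "inv f \<in> idems B" using f by (rule subgroup.m_inv_closed[OF subgroup_idems])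
  then have "inv (a \<otimes> f) = lam B (inv f) (inv a)"
    using a fc by (simp add: inv_mult_group idem_mult)
  moreover have "lam B f (lam B (inv f) (inv a)) = inv a"
    using lam_mult[of f "inv f" "inv a"] a fc by (simp add: lam_one)
  ultimately show ?thesis using a fc by (simp add: lam_mult lam_closed)
qed

lemma lam_inv_gpart:
  assumes b: "b \<in> carrier B"
  shows "lam B (gpart B b) (inv (gpart B b)) = lam B b (inv b)"
proof -
  obtain f where "f \<in> idems B" "b = gpart B b \<otimes> f" using decomp_mult[OF b] .
  moreover have "gpart B b \<in> carrier B" using b by (simp add: gpart_eq plus_closed)
  ultimately show ?thesis using lam_inv_mult_idem[of "gpart B b" f] by simp
qed

text \<open>
  The semigroup \<open>(B, \<boxplus>)\<close> need not be right cancellative; right cancellation holds up to the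
  component in \<open>E\<close>. The element \<open>\<lambda>\<^sub>b(b\<^sup>-)\<close> can be removed because adding \<open>b + 0\<close> to it on the
  right gives \<open>0\<close>.
\<close>

lemma plus_lam_inv_eq_iff:
  assumes x: "x \<in> carrier B" and y: "y \<in> carrier B" and b: "b \<in> carrier B"
  shows "x \<boxplus> lam B b (inv b) = y \<boxplus> lam B b (inv b) \<longleftrightarrow> x \<boxplus> \<one> = y \<boxplus> \<one>"
proof -
  let ?l = "lam B b (inv b)"
  have l: "?l \<in> carrier B" using b by (simp add: lam_closed)
  have "(b \<boxplus> ?l) \<boxplus> b = b" using b by (simp add: plus_lam_inv one_plus)
  then have "((b \<boxplus> ?l) \<boxplus> b) \<boxplus> \<one> = b \<boxplus> \<one>" by simp
  then have "b \<boxplus> ((?l \<boxplus> b) \<boxplus> \<one>) = b \<boxplus> \<one>" using b l by (simp add: plus_assoc plus_closed)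
  then have r: "?l \<boxplus> (b \<boxplus> \<one>) = \<one>"
    using plus_left_cancel[of b "(?l \<boxplus> b) \<boxplus> \<one>" \<one>] b l by (simp add: plus_assoc plus_closed)
  have to_one: "z \<boxplus> \<one> = (z \<boxplus> ?l) \<boxplus> (b \<boxplus> \<one>)" if "z \<in> carrier B" for z
    using that b l r by (simp add: plus_assoc plus_closed)
  have from_one: "z \<boxplus> ?l = (z \<boxplus> \<one>) \<boxplus> ?l" if "z \<in> carrier B" for z
    using that l by (simp add: plus_assoc one_plus)
  show ?thesis using to_one[OF x] to_one[OF y] from_one[OF x] from_one[OF y] by metis
qed

lemma dot_eq_dot_gpart_iff:
  assumes a: "a \<in> carrier B" and b: "b \<in> carrier B"
  shows "dot B a b = dot B (gpart B a) (gpart B b) \<longleftrightarrow>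
    (a \<otimes> b) \<boxplus> \<one> = (gpart B a \<otimes> gpart B b) \<boxplus> \<one>"
proof -
  let ?k = "lam B a (inv a)" and ?l = "lam B b (inv b)"
  have k: "?k \<in> carrier B" and l: "?l \<in> carrier B" using a b by (simp_all add: lam_closed)
  have c: "a \<otimes> b \<in> carrier B" "gpart B a \<otimes> gpart B b \<in> carrier B"
    using a b by (simp_all add: gpart_eq plus_closed)
  have "dot B a b = dot B (gpart B a) (gpart B b) \<longleftrightarrow>
      ?k \<boxplus> ((a \<otimes> b) \<boxplus> ?l) = ?k \<boxplus> ((gpart B a \<otimes> gpart B b) \<boxplus> ?l)"
    unfolding dot_def lam_inv_gpart[OF a] lam_inv_gpart[OF b]
    using k l c by (simp add: plus_assoc)
  also have "\<dots> \<longleftrightarrow> (a \<otimes> b) \<boxplus> ?l = (gpart B a \<otimes> gpart B b) \<boxplus> ?l"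
    using plus_left_cancel[OF k] k l c plus_closed by metis
  also have "\<dots> \<longleftrightarrow> (a \<otimes> b) \<boxplus> \<one> = (gpart B a \<otimes> gpart B b) \<boxplus> \<one>"
    using c b by (rule plus_lam_inv_eq_iff)
  finally show ?thesis .
qed

lemma idems_Int_gset: "idems B \<inter> gset B = {\<one>}"
proof (intro equalityI subsetI)
  fix x assume x: "x \<in> idems B \<inter> gset B"
  then have "x = x \<boxplus> \<one>" using gset_plus_one by auto
  also have "x \<boxplus> \<one> = \<one>" using x idem_plus by simp
  finally show "x \<in> {\<one>}" by simp
next
  fix x assume "x \<in> {\<one>}"
  then show "x \<in> idems B \<inter> gset B"
    using one_idem plus_one_gset[of \<one>] by (simp add: one_plus)
qed

lemma ideal_idems_iff_normal: "semi_brace_ideal B (idems B) \<longleftrightarrow> idems B \<lhd> B"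
proof -
  have "{\<one>} \<lhd> add_group B"
    using group.one_is_normal[OF group_add_group] by (simp add: add_group_def)
  moreover have "rho B b \<one> \<in> idems B" if "b \<in> carrier B" for b
    using that by (simp add: rho_def one_plus one_idem)
  ultimately show ?thesis
    unfolding semi_brace_ideal_def idems_Int_gset
    by (auto simp: idems_carrier idem_plus lam_idems gset_carrier)
qed

lemma normal_idems_iff:
  "idems B \<lhd> B \<longleftrightarrow> (\<forall>a \<in> carrier B. \<forall>b \<in> carrier B.
    (a \<otimes> b) \<boxplus> \<one> = (gpart B a \<otimes> gpart B b) \<boxplus> \<one>)"
proof
  assume N: "idems B \<lhd> B"
  show "\<forall>a \<in> carrier B. \<forall>b \<in> carrier B.
    (a \<otimes> b) \<boxplus> \<one> = (gpart B a \<otimes> gpart B b) \<boxplus> \<one>"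
  proof (intro ballI)
    fix a b assume a: "a \<in> carrier B" and b: "b \<in> carrier B"
    let ?g = "gpart B a" and ?h = "gpart B b"
    have c: "?g \<in> carrier B" "?h \<in> carrier B" using a b by (simp_all add: gpart_eq plus_closed)
    obtain e where e: "e \<in> idems B" "a = ?g \<otimes> e" using decomp_mult[OF a] .
    obtain f where f: "f \<in> idems B" "b = ?h \<otimes> f" using decomp_mult[OF b] .
    have ec: "e \<in> carrier B" "f \<in> carrier B" using e(1) f(1) by (simp_all add: idems_carrier)
    have "inv (?g \<otimes> ?h) \<otimes> (a \<otimes> b) = inv (?g \<otimes> ?h) \<otimes> ((?g \<otimes> e) \<otimes> (?h \<otimes> f))"
      using e(2) f(2) by simp
    also have "\<dots> = (inv ?h \<otimes> e \<otimes> ?h) \<otimes> f"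
    proof -
      have "inv ?g \<otimes> (?g \<otimes> z) = z" if "z \<in> carrier B" for z
        using that c(1) by (simp add: m_assoc[symmetric])
      then show ?thesis using c ec by (simp add: inv_mult_group m_assoc)
    qed
    also have "\<dots> \<in> idems B"
      using normal.inv_op_closed1[OF N c(2) e(1)] f(1) subgroup.m_closed[OF subgroup_idems]
      by blast
    finally show "(a \<otimes> b) \<boxplus> \<one> = (?g \<otimes> ?h) \<boxplus> \<one>"
      using a b c by (simp add: plus_one_eq_iff)
  qed
next
  assume H: "\<forall>a \<in> carrier B. \<forall>b \<in> carrier B.
    (a \<otimes> b) \<boxplus> \<one> = (gpart B a \<otimes> gpart B b) \<boxplus> \<one>"
  have conj: "inv b \<otimes> (e \<otimes> b) \<in> idems B" if e: "e \<in> idems B" and b: "b \<in> carrier B" for e b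
  proof -
    have ec: "e \<in> carrier B" using e by (rule idems_carrier)
    have "gpart B e = \<one>" using e ec by (simp add: gpart_eq idem_plus)
    then have "(e \<otimes> b) \<boxplus> \<one> = (\<one> \<otimes> gpart B b) \<boxplus> \<one>" using H ec b by metis
    also have "\<dots> = b \<boxplus> \<one>" using b by (simp add: gpart_eq plus_closed plus_assoc one_plus)
    finally show ?thesis using ec b by (simp add: plus_one_eq_iff)
  qed
  have "x \<otimes> e \<otimes> inv x \<in> idems B" if "x \<in> carrier B" "e \<in> idems B" for x e
    using conj[of e "inv x"] that by (simp add: m_assoc idems_carrier)
  then show "idems B \<lhd> B" using subgroup_idems by (simp add: normal_inv_iff)
qed

end

theorem corollary14:
  fixes B :: "('a, 'm) semi_brace_scheme"
  assumes "left_semi_brace B"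
  shows "semi_brace_ideal B (idems B) \<longleftrightarrow>
    (\<forall>a \<in> carrier B. \<forall>b \<in> carrier B. dot B a b = dot B (gpart B a) (gpart B b))"
proof -
  interpret left_semi_brace B by (rule assms)
  show ?thesis
    by (simp add: ideal_idems_iff_normal normal_idems_iff dot_eq_dot_gpart_iff)
qed

end
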